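(* Let $1<r<\sqrt2$. For every $\epsilon\in(0,1)$ and every $n\in\mathbb{N}$ with $n\geq \ln(4)/\epsilon$ there exist $D\in\mathbb{N}$ and a probability measure $\mu$ on $\mathbb{R}^D$ such that: (i) for $\mathbf{X}=(X_1,\dots,X_n)\sim\mu^n$, $\min\{\mathbb{V}(\hat M(\mathbf{X},r)),\mathbb{V}(G(\mathbf{X},r))\}\geq \frac14-\epsilon$; (ii) for $\mathbf{X}\sim\mu^n$, the event $B=\{\forall i,j\in[n]\text{ with } i\neq j,\ \|X_i-X_j\|>r\text{ and }\|X_i\|\leq 1\}$ satisfies $\mathbb{P}(B)\geq \frac12-\epsilon$; (iii) for every $f:(\mathbb{R}^D)^n\to\mathbb{R}$ there exists a probability measure $\mu''$ on $\mathbb{R}^D$ such that for $\mathbf{X}\sim(\mu'')^n$ $$\mathbb{E}\big[(f(\mathbf{X})-M(\mu'',n,r))^2\big]\geq \frac{(1-\epsilon)^2}{16},$$ and consequently $\|M(\mu'',n,r)-f(\mathbf{X})\|_{L_2((\mu'')^n)}\geq(1-\epsilon)/4$.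
   Context: $\mathbb{R}^D$ carries the Euclidean norm $\|\cdot\|$ and the metric $d(x,y)=\|x-y\|$; $[n]=\{1,\dots,n\}$; $B(x,r)=\{y:\|x-y\|\leq r\}$. For a Borel probability measure $\mu$ on $\mathbb{R}^D$ and $\mathbf{X}=(X_1,\dots,X_n)\sim\mu^n$ (i.i.d. with law $\mu$): $\hat M(\mathbf{X},r)=\mu\big(\bigcap_{k\in[n]}B(X_k,r)^c\big)$ is the conditional missing mass, $M(\mu,n,r)=\mathbb{E}[\hat M(\mathbf{X},r)]$ is the expected missing mass, and $G(\mathbf{X},r)=\frac1n\sum_{k=1}^n\mathbf{1}\{X_k\in\bigcap_{i\in[n]:i\neq k}B(X_i,r)^c\}$ is the Good-Turing estimator. $\mathbb{V}$ denotes variance. *)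

theory Defs
  imports "HOL-Probability.Probability"
begin

text \<open>
  The dimension is existentially quantified in the theorem, so it cannot be a type. A point of
  \<open>D\<close>-dimensional Euclidean space is a function \<open>x :: nat \<Rightarrow> real\<close> that is extensional on \<open>{..<D}\<close>.
  The product sigma-algebra is the Borel sigma-algebra of the Euclidean topology, because the
  index set is finite and the real line is second countable.
\<close>

definition borel_RD :: "nat \<Rightarrow> (nat \<Rightarrow> real) measure" where
  "borel_RD D = (\<Pi>\<^sub>M i\<in>{..<D}. (borel :: real measure))"

definition norm_RD :: "nat \<Rightarrow> (nat \<Rightarrow> real) \<Rightarrow> real" where
  "norm_RD D x = L2_set x {..<D}"

definition dist_RD :: "nat \<Rightarrow> (nat \<Rightarrow> real) \<Rightarrow> (nat \<Rightarrow> real) \<Rightarrow> real" where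
  "dist_RD D x y = norm_RD D (\<lambda>i. x i - y i)"

definition cball_RD :: "nat \<Rightarrow> (nat \<Rightarrow> real) \<Rightarrow> real \<Rightarrow> (nat \<Rightarrow> real) set" where
  "cball_RD D x r = {y \<in> space (borel_RD D). dist_RD D x y \<le> r}"

definition borel_prob_RD :: "nat \<Rightarrow> (nat \<Rightarrow> real) measure \<Rightarrow> bool" where
  "borel_prob_RD D \<mu> \<longleftrightarrow> prob_space \<mu> \<and> sets \<mu> = sets (borel_RD D)"

definition sample_law :: "(nat \<Rightarrow> real) measure \<Rightarrow> nat \<Rightarrow> (nat \<Rightarrow> nat \<Rightarrow> real) measure" where
  "sample_law \<mu> n = (\<Pi>\<^sub>M k\<in>{1..n}. \<mu>)"

definition cond_missing_mass ::
    "nat \<Rightarrow> (nat \<Rightarrow> real) measure \<Rightarrow> nat \<Rightarrow> real \<Rightarrow> (nat \<Rightarrow> nat \<Rightarrow> real) \<Rightarrow> real" where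
  "cond_missing_mass D \<mu> n r X =
     measure \<mu> (space (borel_RD D) \<inter> (\<Inter>k\<in>{1..n}. - cball_RD D (X k) r))"

definition missing_mass :: "nat \<Rightarrow> (nat \<Rightarrow> real) measure \<Rightarrow> nat \<Rightarrow> real \<Rightarrow> real" where
  "missing_mass D \<mu> n r =
     prob_space.expectation (sample_law \<mu> n) (cond_missing_mass D \<mu> n r)"

definition good_turing :: "nat \<Rightarrow> nat \<Rightarrow> real \<Rightarrow> (nat \<Rightarrow> nat \<Rightarrow> real) \<Rightarrow> real" where
  "good_turing D n r X =
     1 / real n *
       (\<Sum>k\<in>{1..n}. indicator (\<Inter>i\<in>{i\<in>{1..n}. i \<noteq> k}. - cball_RD D (X i) r) (X k))"

text \<open>
  Mean squares of estimators are taken in the extended nonnegative reals, so that an estimator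
  without a finite second moment has infinite risk (the Bochner integral would be 0). For a
  non-measurable integrand, \<open>nn_integral\<close> is the lower integral, so a lower bound on it bounds
  every reading of the expectation.
\<close>

definition mean_square :: "'a measure \<Rightarrow> ('a \<Rightarrow> real) \<Rightarrow> ennreal" where
  "mean_square P g = (\<integral>\<^sup>+ x. ennreal ((g x)\<^sup>2) \<partial>P)"

definition L2_norm :: "'a measure \<Rightarrow> ('a \<Rightarrow> real) \<Rightarrow> ennreal" where
  "L2_norm P g =
     (if mean_square P g = \<infinity> then \<infinity> else ennreal (sqrt (enn2real (mean_square P g))))"

end

theory Submission
  imports Defs
begin

text \<open>
  Let \<open>\<mu>\<close> put mass \<open>1 - a\<close> on the origin and spread the mass \<open>a\<close> uniformly over the \<open>D\<close> standard
  basis vectors, with \<open>D\<close> much larger than \<open>n\<^sup>2\<close>. Since \<open>1 < r < sqrt 2\<close>, a ball around the origin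
  covers the whole support, whereas a ball around a basis vector covers only that vector and the
  origin. Hence one sample at the origin makes both the missing mass and the Good-Turing estimator
  vanish; if the origin is not sampled, which has probability \<open>a ^ n\<close>, then most likely all samples
  are distinct and both quantities are close to \<open>1\<close>. Taking \<open>a ^ n = 1/2\<close> gives (i) and (ii).

  For (iii), the measures with \<open>a ^ n = 1/4\<close> and with \<open>a = 1\<close> induce the same conditional law of the
  sample given that the origin is not sampled, but their expected missing masses are at most \<open>1/4\<close>
  and nearly \<open>1\<close>, so no estimator is accurate for both. The value \<open>q = a ^ n = 1/4\<close> maximizes the
  resulting two-point bound \<open>sqrt q * (1 - sqrt q)\<close> on the root mean square error.
\<close>

section \<open>Transfer between discrete laws and their images; variance from two events\<close>

text \<open>Reduces every computation under the product law to the discrete product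
  \<open>Pi_pmf\<close>. The default \<open>d\<close> is arbitrary because the map reads only the
  coordinates in \<open>I\<close>.\<close>

lemma PiM_distr_pmf:
  assumes "finite I" and h: "\<And>x. h x \<in> space N"
  shows "(\<Pi>\<^sub>M k\<in>I. distr (measure_pmf p) N h) =
    distr (measure_pmf (Pi_pmf I d (\<lambda>_. p))) (\<Pi>\<^sub>M k\<in>I. N) (\<lambda>\<omega>. \<lambda>k\<in>I. h (\<omega> k))"
proof -
  let ?M = "\<lambda>k::'a. distr (measure_pmf p) N h"
  let ?F = "\<lambda>\<omega>. \<lambda>k\<in>I. h (\<omega> k)"
  have hm: "h \<in> measurable (measure_pmf p) N"
    using h by (simp add: measurable_def)
  have Fm: "?F \<in> measurable (measure_pmf (Pi_pmf I d (\<lambda>_. p))) (\<Pi>\<^sub>M k\<in>I. N)"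
    using h by (auto simp: measurable_def space_PiM)
  interpret product_prob_space ?M
    by (intro product_prob_spaceI prob_space.prob_space_distr hm measure_pmf.prob_space_axioms)
  have "distr (measure_pmf (Pi_pmf I d (\<lambda>_. p))) (\<Pi>\<^sub>M k\<in>I. N) ?F = PiM I ?M"
  proof (rule PiM_eqI)
    show "sets (distr (measure_pmf (Pi_pmf I d (\<lambda>_. p))) (\<Pi>\<^sub>M k\<in>I. N) ?F) = sets (PiM I ?M)"
      by (simp cong: sets_PiM_cong)
  next
    fix A assume A: "\<And>k. k \<in> I \<Longrightarrow> A k \<in> sets (?M k)"
    have "emeasure (distr (measure_pmf (Pi_pmf I d (\<lambda>_. p))) (\<Pi>\<^sub>M k\<in>I. N) ?F) (Pi\<^sub>E I A)
        = emeasure (measure_pmf (Pi_pmf I d (\<lambda>_. p))) (?F -` Pi\<^sub>E I A)"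
      using A assms(1) by (subst emeasure_distr[OF Fm]) (auto intro: sets_PiM_I_finite)
    also have "?F -` Pi\<^sub>E I A = Pi I (\<lambda>k. h -` A k)"
      by (auto simp: PiE_def Pi_def)
    also have "emeasure (measure_pmf (Pi_pmf I d (\<lambda>_. p))) \<dots> =
        (\<Prod>k\<in>I. emeasure (measure_pmf p) (h -` A k))"
      by (simp add: measure_pmf.emeasure_eq_measure measure_Pi_pmf_Pi[OF assms(1)] prod_ennreal)
    also have "\<dots> = (\<Prod>k\<in>I. emeasure (?M k) (A k))"
      using A by (intro prod.cong) (simp_all add: emeasure_distr[OF hm])
    finally show "emeasure (distr (measure_pmf (Pi_pmf I d (\<lambda>_. p))) (\<Pi>\<^sub>M k\<in>I. N) ?F) (Pi\<^sub>E I A)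
        = (\<Prod>k\<in>I. emeasure (?M k) (A k))" .
  qed fact
  then show ?thesis ..
qed

text \<open>Wherever the mean lies, its distances to the half-lines below \<open>0\<close> and above
  \<open>c\<close> add up to at least \<open>c\<close>, so their squares add up to at least
  \<open>c^2 / 2\<close>. With \<open>c\<close> near 1 and \<open>q\<close> near 1/2 this gives
  nearly 1/4, the largest variance possible for values in the unit interval.\<close>

lemma (in prob_space) variance_ge_two_sets:
  fixes Z :: "'a \<Rightarrow> real"
  assumes Z: "Z \<in> borel_measurable M" and bd: "\<And>x. x \<in> space M \<Longrightarrow> \<bar>Z x\<bar> \<le> K"
    and AB: "A \<in> events" "B \<in> events" "A \<inter> B = {}" and "0 \<le> c" "0 \<le> q"
    and ZA: "\<And>x. x \<in> A \<Longrightarrow> Z x \<le> 0" and ZB: "\<And>x. x \<in> B \<Longrightarrow> c \<le> Z x"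
    and q: "q \<le> prob A" "q \<le> prob B"
  shows "q * c\<^sup>2 / 2 \<le> variance Z"
proof -
  define m where "m = expectation Z"
  define u where "u = max m 0"
  define v where "v = max (c - m) 0"
  have int: "integrable M (\<lambda>x. (Z x - m)\<^sup>2)"
  proof (rule integrable_const_bound)
    show "AE x in M. norm ((Z x - m)\<^sup>2) \<le> (K + \<bar>m\<bar>)\<^sup>2"
    proof (rule AE_I2)
      fix x assume "x \<in> space M"
      from bd[OF this] show "norm ((Z x - m)\<^sup>2) \<le> (K + \<bar>m\<bar>)\<^sup>2"
        by (simp add: abs_le_square_iff[symmetric])
    qed
  qed (use Z in measurable)
  have "c\<^sup>2 / 2 \<le> u\<^sup>2 + v\<^sup>2"
  proof -
    have "c \<le> u + v" by (auto simp: u_def v_def)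
    then have "c\<^sup>2 \<le> (u + v)\<^sup>2" using \<open>0 \<le> c\<close> by (rule power_mono)
    also have "\<dots> \<le> 2 * (u\<^sup>2 + v\<^sup>2)"
      using zero_le_power2[of "u - v"] by (simp add: power2_eq_square algebra_simps)
    finally show ?thesis by simp
  qed
  then have "q * (c\<^sup>2 / 2) \<le> q * (u\<^sup>2 + v\<^sup>2)" using \<open>0 \<le> q\<close> by (rule mult_left_mono)
  also have "\<dots> \<le> u\<^sup>2 * prob A + v\<^sup>2 * prob B"
    using mult_left_mono[OF q(1), of "u\<^sup>2"] mult_left_mono[OF q(2), of "v\<^sup>2"]
    by (simp add: algebra_simps)
  also have "\<dots> = (\<integral>x. u\<^sup>2 * indicator A x + v\<^sup>2 * indicator B x \<partial>M)"
    using AB(1,2) by (subst Bochner_Integration.integral_add) (auto simp: emeasure_eq_measure)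
  also have "\<dots> \<le> (\<integral>x. (Z x - m)\<^sup>2 \<partial>M)"
  proof (rule integral_mono[OF _ int])
    fix x
    have "u\<^sup>2 \<le> (Z x - m)\<^sup>2" if "x \<in> A"
      using ZA[OF that] unfolding abs_le_square_iff[symmetric] by (auto simp: u_def)
    moreover have "v\<^sup>2 \<le> (Z x - m)\<^sup>2" if "x \<in> B"
      using ZB[OF that] unfolding abs_le_square_iff[symmetric] by (auto simp: v_def)
    ultimately show "u\<^sup>2 * indicator A x + v\<^sup>2 * indicator B x \<le> (Z x - m)\<^sup>2"
      using AB(3) by (auto simp: indicator_def)
  qed (use AB in \<open>auto simp: emeasure_eq_measure\<close>)
  finally show ?thesis by (simp add: m_def)
qed

lemma nn_integral_distr_ge:
  assumes F: "\<And>\<omega>. F \<omega> \<in> space N" and fin: "finite (set_pmf p)"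
    and sing: "\<And>x. x \<in> space N \<Longrightarrow> {x} \<in> sets N"
  shows "(\<integral>\<^sup>+\<omega>. g (F \<omega>) \<partial>measure_pmf p) \<le> (\<integral>\<^sup>+x. g x \<partial>distr (measure_pmf p) N F)"
proof -
  let ?S = "F ` set_pmf p"
  \<comment> \<open>a measurable minorant of \<open>g\<close> that agrees with it on the support\<close>
  let ?g = "\<lambda>x. \<Sum>y\<in>?S. g y * indicator {y} x"
  have eq: "?g x = (if x \<in> ?S then g x else 0)" for x
  proof -
    have "?g x = (\<Sum>y\<in>?S. if y = x then g y else 0)"
      by (intro sum.cong) (auto simp: indicator_def)
    then show ?thesis using fin by simp
  qed
  have Fm: "F \<in> measurable (measure_pmf p) N"
    using F by (simp add: measurable_def)
  have "(\<integral>\<^sup>+\<omega>. g (F \<omega>) \<partial>measure_pmf p) = (\<integral>\<^sup>+\<omega>. ?g (F \<omega>) \<partial>measure_pmf p)"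
    unfolding eq by (intro nn_integral_cong_AE) (auto simp: AE_measure_pmf_iff)
  also have "\<dots> = (\<integral>\<^sup>+x. ?g x \<partial>distr (measure_pmf p) N F)"
    by (rule nn_integral_distr[symmetric, OF Fm])
      (use sing F in \<open>auto intro!: borel_measurable_sum borel_measurable_times_ennreal borel_measurable_indicator\<close>)
  also have "\<dots> \<le> (\<integral>\<^sup>+x. g x \<partial>distr (measure_pmf p) N F)"
    unfolding eq by (intro nn_integral_mono) auto
  finally show ?thesis .
qed

text \<open>Multiplying the pointwise inequalities over \<open>I\<close> compares the product
  densities; an outcome that deviates from \<open>d\<close> outside \<open>I\<close> has density 0
  on both sides.\<close>

lemma Pi_pmf_ge:
  assumes "finite I" "0 \<le> a" and le: "\<And>x. a * pmf p' x \<le> pmf p x"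
  shows "a ^ card I * pmf (Pi_pmf I d (\<lambda>_. p')) \<omega> \<le> pmf (Pi_pmf I d (\<lambda>_. p)) \<omega>"
proof -
  have "(\<Prod>k\<in>I. a * pmf p' (\<omega> k)) \<le> (\<Prod>k\<in>I. pmf p (\<omega> k))"
    using assms by (intro prod_mono) auto
  then show ?thesis
    using assms(1) by (auto simp: pmf_Pi prod.distrib)
qed

lemma nn_integral_pmf_ge:
  assumes "0 \<le> c" and le: "\<And>x. c * pmf p' x \<le> pmf p x"
  shows "ennreal c * (\<integral>\<^sup>+x. g x \<partial>measure_pmf p') \<le> (\<integral>\<^sup>+x. g x \<partial>measure_pmf p)"
proof -
  have "ennreal c * (\<integral>\<^sup>+x. g x \<partial>measure_pmf p') =
      (\<integral>\<^sup>+x. ennreal (c * pmf p' x) * g x \<partial>count_space UNIV)"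
    using assms(1)
    by (simp add: nn_integral_measure_pmf nn_integral_cmult[symmetric] ennreal_mult mult.assoc)
  also have "\<dots> \<le> (\<integral>\<^sup>+x. g x \<partial>measure_pmf p)"
    unfolding nn_integral_measure_pmf
    by (intro nn_integral_mono mult_right_mono ennreal_leI le) simp
  finally show ?thesis .
qed

section \<open>Measurability on the sample space of an arbitrary Borel law\<close>

context
  fixes D n :: nat and \<mu> :: "(nat \<Rightarrow> real) measure"
  assumes sets_mu: "sets \<mu> = sets (borel_RD D)"
begin

lemma sample_coord_measurable [measurable]:
  assumes "k \<in> {1..n}" "l < D"
  shows "(\<lambda>X. X k l) \<in> borel_measurable (sample_law \<mu> n)"
proof -
  have "(\<lambda>x. x l) \<in> borel_measurable \<mu>"
    unfolding measurable_cong_sets[OF sets_mu refl] borel_RD_def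
    using assms(2) by (intro measurable_component_singleton) simp
  moreover have "(\<lambda>X. X k) \<in> measurable (sample_law \<mu> n) \<mu>"
    unfolding sample_law_def using assms(1) by (rule measurable_component_singleton)
  ultimately show ?thesis by (rule measurable_compose[rotated])
qed

lemma dist_RD_sample_measurable [measurable]:
  assumes "i \<in> {1..n}" "j \<in> {1..n}"
  shows "(\<lambda>X. dist_RD D (X i) (X j)) \<in> borel_measurable (sample_law \<mu> n)"
  unfolding dist_RD_def norm_RD_def L2_set_def using assms by measurable

lemma dist_RD_sample_const_measurable [measurable]:
  assumes "i \<in> {1..n}"
  shows "(\<lambda>X. dist_RD D (X i) y) \<in> borel_measurable (sample_law \<mu> n)"
  unfolding dist_RD_def norm_RD_def L2_set_def using assms by measurable

lemma norm_RD_sample_measurable [measurable]: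
  assumes "i \<in> {1..n}"
  shows "(\<lambda>X. norm_RD D (X i)) \<in> borel_measurable (sample_law \<mu> n)"
  unfolding norm_RD_def L2_set_def using assms by measurable

lemma space_sampleD:
  assumes "X \<in> space (sample_law \<mu> n)" "k \<in> {1..n}"
  shows "X k \<in> space (borel_RD D)"
  using assms sets_eq_imp_space_eq[OF sets_mu] by (auto simp: sample_law_def space_PiM)

text \<open>The restriction to the sample space matters: the complement of a ball also contains
  every function outside \<open>space (borel_RD D)\<close>, whatever its distance to the
  centre.\<close>

lemma good_turing_eq:
  assumes "X \<in> space (sample_law \<mu> n)"
  shows "good_turing D n r X =
    1 / real n * (\<Sum>k\<in>{1..n}. of_bool (\<forall>i\<in>{1..n}. i \<noteq> k \<longrightarrow> r < dist_RD D (X i) (X k)))"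
  unfolding good_turing_def
  using space_sampleD[OF assms]
  by (intro arg_cong2[where f = "(*)"] sum.cong refl)
    (auto simp: indicator_def cball_RD_def not_le)

lemma good_turing_measurable:
  "good_turing D n r \<in> borel_measurable (sample_law \<mu> n)"
proof -
  have "(\<lambda>X. 1 / real n * (\<Sum>k\<in>{1..n}.
      of_bool (\<forall>i\<in>{1..n}. i \<noteq> k \<longrightarrow> r < dist_RD D (X i) (X k)))) \<in> borel_measurable (sample_law \<mu> n)"
    by measurable
  then show ?thesis
    by (subst measurable_cong[OF good_turing_eq])
qed

text \<open>A point is a finite product of points, first over coordinates and then over samples.
  This makes the minorant in \<open>nn_integral_distr_ge\<close> measurable.\<close>

lemma singleton_sample_measurable:
  assumes "X \<in> space (sample_law \<mu> n)"
  shows "{X} \<in> sets (sample_law \<mu> n)"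
proof -
  have sing: "{x} \<in> sets \<mu>" if "x \<in> space \<mu>" for x
  proof -
    have x: "x \<in> extensional {..<D}"
      using that by (auto simp: sets_eq_imp_space_eq[OF sets_mu] borel_RD_def space_PiM PiE_def)
    have "Pi\<^sub>E {..<D} (\<lambda>l. {x l}) \<in> sets (borel_RD D)"
      unfolding borel_RD_def by (intro sets_PiM_I_finite) auto
    also have "Pi\<^sub>E {..<D} (\<lambda>l. {x l}) = {x}"
      using x by (auto simp: PiE_def Pi_def intro: extensionalityI)
    finally show ?thesis using sets_mu by simp
  qed
  have X: "X \<in> extensional {1..n}" "\<And>k. k \<in> {1..n} \<Longrightarrow> X k \<in> space \<mu>"
    using assms by (auto simp: sample_law_def space_PiM PiE_def Pi_def)
  have "Pi\<^sub>E {1..n} (\<lambda>k. {X k}) \<in> sets (sample_law \<mu> n)"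
    unfolding sample_law_def using sing[OF X(2)] by (intro sets_PiM_I_finite) auto
  also have "Pi\<^sub>E {1..n} (\<lambda>k. {X k}) = {X}"
    using X(1) by (auto simp: PiE_def Pi_def simp del: atLeastAtMost_iff intro: extensionalityI)
  finally show ?thesis .
qed

end

subsection \<open>The spiked uniform distribution on the vertices of a simplex\<close>

text \<open>A law on labels: those below \<open>D\<close> stand for the basis vectors, and
  \<open>D\<close> itself for the origin.\<close>

definition spiked_uniform :: "nat \<Rightarrow> real \<Rightarrow> nat pmf" where
  "spiked_uniform D a =
     bind_pmf (bernoulli_pmf a) (\<lambda>b. if b then pmf_of_set {..<D} else return_pmf D)"

text \<open>A label \<open>x\<close> with \<open>D \<le> x\<close> matches no coordinate and thus
  yields the origin.\<close>

definition vertex :: "nat \<Rightarrow> nat \<Rightarrow> nat \<Rightarrow> real" where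
  "vertex D x = (\<lambda>l\<in>{..<D}. if l = x then 1 else 0)"

lemma vertex_in_space: "vertex D x \<in> space (borel_RD D)"
  by (simp add: borel_RD_def space_PiM vertex_def)

lemma norm_RD_vertex: "norm_RD D (vertex D x) \<le> 1"
  unfolding norm_RD_def L2_set_def vertex_def
  by (simp add: if_distrib[of "\<lambda>t. t\<^sup>2"] cong: if_cong)

text \<open>Distinct labels never share a nonzero coordinate, so the squared distance counts how
  many of the two points are basis vectors.\<close>

lemma dist_RD_vertex:
  "dist_RD D (vertex D x) (vertex D y) =
     (if x = y then 0 else sqrt (of_bool (x < D) + of_bool (y < D)))"
proof (cases "x = y")
  case False
  have "(\<Sum>l<D. (vertex D x l - vertex D y l)\<^sup>2) =
      (\<Sum>l<D. (if l = x then 1 else 0) + (if l = y then 1 else 0))"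
    using False by (intro sum.cong) (auto simp: vertex_def)
  then show ?thesis
    using False by (simp add: dist_RD_def norm_RD_def L2_set_def sum.distrib)
qed (simp add: dist_RD_def norm_RD_def L2_set_def)

text \<open>The possible distances are 0, 1 and \<open>sqrt 2\<close>, and \<open>r\<close> lies
  strictly between the last two.\<close>

lemma less_dist_RD_vertex_iff:
  assumes "1 < r" "r < sqrt 2"
  shows "r < dist_RD D (vertex D x) (vertex D y) \<longleftrightarrow> x \<noteq> y \<and> x < D \<and> y < D"
  using assms by (auto simp: dist_RD_vertex not_less)

lemma pmf_spiked_uniform:
  assumes "0 < D" "0 \<le> a" "a \<le> 1"
  shows "pmf (spiked_uniform D a) x =
    (if x < D then a / real D else if x = D then 1 - a else 0)"
  using assms by (auto simp: spiked_uniform_def pmf_bind lessThan_empty_iff indicator_def)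

locale spiked_sample =
  fixes D n :: nat and a r :: real
  assumes D: "0 < D" and n: "2 \<le> n" and a: "0 \<le> a" "a \<le> 1" and r: "1 < r" "r < sqrt 2"
begin

section \<open>Independent label draws and their image in Euclidean space\<close>

declare atLeastAtMost_iff [simp del] One_nat_def [simp del]

abbreviation "P \<equiv> spiked_uniform D a"
definition "\<mu> = distr (measure_pmf P) (borel_RD D) (vertex D)"
definition "Ind = Pi_pmf {1..n} (0::nat) (\<lambda>_. P)"
definition "draw \<omega> = (\<lambda>k\<in>{1..n}. vertex D (\<omega> k))" for \<omega> :: "nat \<Rightarrow> nat"

text \<open>Uses \<open>D \<le> \<omega> k\<close> instead of equality so that the values of the
  estimators are known for every \<open>\<omega>\<close>, including those of probability 0.\<close>

definition "spike_hit = {\<omega>. \<exists>k\<in>{1..n}. D \<le> \<omega> k}"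
definition "distinct_draws = {\<omega>. (\<forall>k\<in>{1..n}. \<omega> k < D) \<and> inj_on \<omega> {1..n}}"

lemma pmf_P: "pmf P x = (if x < D then a / real D else if x = D then 1 - a else 0)"
  by (rule pmf_spiked_uniform) (use D a in auto)

lemma finite_set_P: "finite (set_pmf P)"
  by (rule finite_subset[of _ "{..D}"]) (auto simp: set_pmf_eq pmf_P split: if_splits)

lemma prob_P: "S \<subseteq> {..<D} \<Longrightarrow> measure_pmf.prob P S = a * real (card S) / real D"
  using finite_subset[of S "{..<D}"]
  by (subst measure_measure_pmf_finite) (auto simp: pmf_P subset_iff)

lemma sets_mu: "sets \<mu> = sets (borel_RD D)"
  by (simp add: \<mu>_def)

lemma vertex_measurable: "vertex D \<in> measurable (measure_pmf P) (borel_RD D)"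
  by (simp add: measurable_def vertex_in_space)

lemma borel_prob_mu: "borel_prob_RD D \<mu>"
  unfolding borel_prob_RD_def \<mu>_def
  by (simp add: measure_pmf.prob_space_distr[OF vertex_measurable])

text \<open>The target is \<open>sample_law \<mu> n\<close> itself, used only for its sigma-algebra,
  so measurability facts about the sample law apply directly to the image measure.\<close>

lemma sample_law_eq: "sample_law \<mu> n = distr (measure_pmf Ind) (sample_law \<mu> n) draw"
proof -
  have "sample_law \<mu> n = distr (measure_pmf Ind) (\<Pi>\<^sub>M k\<in>{1..n}. borel_RD D) draw"
    unfolding sample_law_def \<mu>_def Ind_def draw_def
    by (intro PiM_distr_pmf vertex_in_space) simp
  also have "\<dots> = distr (measure_pmf Ind) (sample_law \<mu> n) draw"
    unfolding sample_law_def by (intro distr_cong sets_PiM_cong) (simp_all add: sets_mu)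
  finally show ?thesis .
qed

lemma draw_in_space: "draw \<omega> \<in> space (sample_law \<mu> n)"
  using vertex_in_space sets_eq_imp_space_eq[OF sets_mu]
  by (auto simp: sample_law_def space_PiM draw_def)

lemma draw_measurable: "draw \<in> measurable (measure_pmf Ind) (sample_law \<mu> n)"
  by (simp add: measurable_def draw_in_space)

lemma expectation_sample_law:
  fixes g :: "(nat \<Rightarrow> nat \<Rightarrow> real) \<Rightarrow> real"
  assumes "g \<in> borel_measurable (sample_law \<mu> n)"
  shows "(\<integral>X. g X \<partial>sample_law \<mu> n) = measure_pmf.expectation Ind (\<lambda>\<omega>. g (draw \<omega>))"
  by (subst sample_law_eq) (rule integral_distr[OF draw_measurable assms])

lemma dist_draw:
  "i \<in> {1..n} \<Longrightarrow> j \<in> {1..n} \<Longrightarrow>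
    r < dist_RD D (draw \<omega> i) (draw \<omega> j) \<longleftrightarrow> \<omega> i \<noteq> \<omega> j \<and> \<omega> i < D \<and> \<omega> j < D"
  by (simp add: draw_def less_dist_RD_vertex_iff[OF r])

text \<open>Stated for every sample point, not only for images of label draws, since measurability
  in \<open>X\<close> is derived from it.\<close>

lemma cond_missing_mass_eq:
  "cond_missing_mass D \<mu> n r X =
     measure_pmf.prob P {x. \<forall>k\<in>{1..n}. r < dist_RD D (X k) (vertex D x)}"
  if "X \<in> space (sample_law \<mu> n)"
proof -
  have [measurable]: "(\<lambda>y. y l) \<in> borel_measurable (borel_RD D)" if "l \<in> {..<D}" for l
    unfolding borel_RD_def using that by (rule measurable_component_singleton)
  have [measurable]: "(\<lambda>y. dist_RD D (X k) y) \<in> borel_measurable (borel_RD D)" for k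
    unfolding dist_RD_def norm_RD_def L2_set_def by measurable
  let ?S = "space (borel_RD D) \<inter> (\<Inter>k\<in>{1..n}. - cball_RD D (X k) r)"
  have S: "?S = {y \<in> space (borel_RD D). \<forall>k\<in>{1..n}. r < dist_RD D (X k) y}"
    by (auto simp: cball_RD_def not_le)
  have "?S \<in> sets (borel_RD D)"
    unfolding S by measurable
  then show ?thesis
    unfolding cond_missing_mass_def \<mu>_def
    by (subst measure_distr[OF vertex_measurable])
      (auto simp: S vertex_in_space intro!: arg_cong[where f = "measure_pmf.prob P"])
qed

text \<open>The finite support turns the missing mass into a finite weighted sum of indicators of
  measurable distance conditions on \<open>X\<close>.\<close>

lemma cond_missing_mass_measurable:
  "cond_missing_mass D \<mu> n r \<in> borel_measurable (sample_law \<mu> n)"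
proof -
  note [measurable] = dist_RD_sample_const_measurable[OF sets_mu]
  have "(\<lambda>X. \<Sum>x\<in>set_pmf P. pmf P x *
      of_bool (\<forall>k\<in>{1..n}. r < dist_RD D (X k) (vertex D x))) \<in> borel_measurable (sample_law \<mu> n)"
    by measurable
  moreover have "cond_missing_mass D \<mu> n r X = (\<Sum>x\<in>set_pmf P. pmf P x *
      of_bool (\<forall>k\<in>{1..n}. r < dist_RD D (X k) (vertex D x)))"
    if "X \<in> space (sample_law \<mu> n)" for X
  proof -
    let ?S = "{x. \<forall>k\<in>{1..n}. r < dist_RD D (X k) (vertex D x)}"
    have "cond_missing_mass D \<mu> n r X = measure_pmf.prob P (?S \<inter> set_pmf P)"
      by (simp add: cond_missing_mass_eq[OF that] measure_Int_set_pmf)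
    also have "\<dots> = (\<Sum>x\<in>set_pmf P. pmf P x * of_bool (x \<in> ?S))"
      using finite_set_P
      by (subst measure_measure_pmf_finite)
        (auto simp: Int_commute intro!: sum.mono_neutral_cong_left)
    finally show ?thesis by simp
  qed
  ultimately show ?thesis
    by (subst measurable_cong)
qed

section \<open>Values of the missing mass and the Good-Turing estimator on draws\<close>

text \<open>A sample at the origin covers the whole support. Otherwise the origin is covered, and
  the uncovered points are exactly the basis vectors not drawn.\<close>

lemma cond_missing_mass_draw:
  "cond_missing_mass D \<mu> n r (draw \<omega>) =
     (if \<omega> \<in> spike_hit then 0 else a * (1 - real (card (\<omega> ` {1..n})) / real D))"
proof -
  let ?S = "{x. \<forall>k\<in>{1..n}. r < dist_RD D (draw \<omega> k) (vertex D x)}"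
  have S: "?S = {x. \<forall>k\<in>{1..n}. \<omega> k \<noteq> x \<and> \<omega> k < D \<and> x < D}"
    by (auto simp: draw_def less_dist_RD_vertex_iff[OF r])
  have eq: "cond_missing_mass D \<mu> n r (draw \<omega>) = measure_pmf.prob P ?S"
    by (rule cond_missing_mass_eq[OF draw_in_space])
  show ?thesis
  proof (cases "\<omega> \<in> spike_hit")
    case True
    then have empty: "?S = {}" unfolding S by (auto simp: spike_hit_def not_less[symmetric])
    show ?thesis unfolding eq empty using True by simp
  next
    case False
    then have sub: "\<omega> ` {1..n} \<subseteq> {..<D}"
      by (auto simp: spike_hit_def not_le)
    \<comment> \<open>\<open>n\<close> enters because \<open>x < D\<close> stands under the
      quantifier over \<open>{1..n}\<close>, which must not be empty.\<close>
    have S': "?S = {..<D} - \<omega> ` {1..n}"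
      unfolding S using sub n by fastforce
    have "card (\<omega> ` {1..n}) \<le> D" using card_mono[OF _ sub] by simp
    then have card: "real (card ({..<D} - \<omega> ` {1..n})) = real D - real (card (\<omega> ` {1..n}))"
      using sub by (subst card_Diff_subset) (auto simp: of_nat_diff)
    then show ?thesis
      using False D unfolding eq S' prob_P[OF Diff_subset] card by (simp add: field_simps)
  qed
qed

text \<open>The sample \<open>j\<close> at the origin is within distance 1 of all others, so none of
  them is isolated; \<open>j\<close> itself is not isolated either, as \<open>2 \<le> n\<close>
  supplies another sample.\<close>

lemma good_turing_draw_hit:
  assumes "\<omega> \<in> spike_hit"
  shows "good_turing D n r (draw \<omega>) = 0"
proof -
  from assms obtain j where j: "j \<in> {1..n}" "D \<le> \<omega> j" by (auto simp: spike_hit_def)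
  have "\<not> (\<forall>i\<in>{1..n}. i \<noteq> k \<longrightarrow> r < dist_RD D (draw \<omega> i) (draw \<omega> k))" if k: "k \<in> {1..n}" for k
  proof (cases "j = k")
    case True
    have "\<exists>i\<in>{1..n}. i \<noteq> k"
      using n by (intro bexI[of _ "if k = 1 then 2 else 1"]) (auto simp: atLeastAtMost_iff)
    then show ?thesis using j True dist_draw[OF _ k] by auto
  next
    case False
    then show ?thesis using j dist_draw[OF _ k] by force
  qed
  then show ?thesis
    unfolding good_turing_eq[OF sets_mu draw_in_space] by (subst sum.neutral) auto
qed

lemma good_turing_draw_distinct:
  assumes "\<omega> \<in> distinct_draws"
  shows "good_turing D n r (draw \<omega>) = 1"
proof -
  have "\<forall>i\<in>{1..n}. i \<noteq> k \<longrightarrow> r < dist_RD D (draw \<omega> i) (draw \<omega> k)" if k: "k \<in> {1..n}" for k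
    using assms k by (auto simp: dist_draw distinct_draws_def inj_on_def)
  then show ?thesis
    unfolding good_turing_eq[OF sets_mu draw_in_space] using n by simp
qed

lemma good_turing_draw_bounds: "\<bar>good_turing D n r (draw \<omega>)\<bar> \<le> 1"
proof -
  have "(\<Sum>k\<in>{1..n}. of_bool (\<forall>i\<in>{1..n}. i \<noteq> k \<longrightarrow> r < dist_RD D (draw \<omega> i) (draw \<omega> k)))
      \<le> (\<Sum>k\<in>{1..n}. (1::real))"
    by (intro sum_mono) auto
  then show ?thesis
    unfolding good_turing_eq[OF sets_mu draw_in_space] using n
    by (subst abs_of_nonneg) (auto simp: divide_le_eq intro!: divide_nonneg_nonneg sum_nonneg)
qed

section \<open>Probabilities of avoiding the origin and of drawing distinct vertices\<close>

lemma prob_no_hit: "measure_pmf.prob Ind (- spike_hit) = a ^ n"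
proof -
  have "- spike_hit = Pi {1..n} (\<lambda>_. {..<D})"
    by (auto simp: spike_hit_def Pi_iff simp flip: not_less)
  then show ?thesis
    using D by (simp add: Ind_def measure_Pi_pmf_Pi prob_P)
qed

lemma prob_hit: "measure_pmf.prob Ind spike_hit = 1 - a ^ n"
  using measure_pmf.prob_compl[of spike_hit Ind] prob_no_hit by (simp add: Compl_eq_Diff_UNIV)

text \<open>The spiked law is a mixture giving weight \<open>a\<close> to the uniform law, hence
  dominates \<open>a\<close> times it. This replaces explicit conditioning on avoiding the
  origin.\<close>

lemma pmf_Ind_ge:
  "a ^ n * pmf (Pi_pmf {1..n} 0 (\<lambda>_. spiked_uniform D 1)) \<omega> \<le> pmf Ind \<omega>"
  using Pi_pmf_ge[of "{1..n}" a "spiked_uniform D 1" P 0 \<omega>] D a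
  by (simp add: Ind_def pmf_spiked_uniform)


text \<open>Each of the \<open>D\<close> possible common values has probability at most
  \<open>1 / D^2\<close>. Coincidences at the origin are excluded, since they need not be
  rare.\<close>

lemma prob_collision:
  assumes "i \<in> {1..n}" "j \<in> {1..n}" "i \<noteq> j"
  shows "measure_pmf.prob Ind {\<omega>. \<omega> i = \<omega> j \<and> \<omega> i < D} \<le> 1 / real D"
proof -
  let ?C = "\<lambda>x. Pi {1..n} (\<lambda>k. if k \<in> {i, j} then {x} else UNIV)"
  have C: "measure_pmf.prob Ind (?C x) \<le> (1 / real D)\<^sup>2" if "x < D" for x
  proof -
    have "measure_pmf.prob Ind (?C x) = (\<Prod>k\<in>{1..n}. if k \<in> {i, j} then a / real D else 1)"
      unfolding Ind_def measure_Pi_pmf_Pi[OF finite_atLeastAtMost]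
      using that by (intro prod.cong) (auto simp: measure_pmf_single pmf_P)
    also have "\<dots> = (\<Prod>k\<in>{1..n} \<inter> {i, j}. a / real D)"
      by (rule prod.inter_restrict[symmetric]) simp
    also have "{1..n} \<inter> {i, j} = {i, j}"
      using assms by auto
    also have "(\<Prod>k\<in>{i, j}. a / real D) = (a / real D)\<^sup>2"
      using assms(3) by (simp add: power2_eq_square)
    also have "\<dots> \<le> (1 / real D)\<^sup>2"
      using a by (intro power_mono divide_right_mono) auto
    finally show ?thesis .
  qed
  have "{\<omega>. \<omega> i = \<omega> j \<and> \<omega> i < D} \<subseteq> (\<Union>x<D. ?C x)"
    by auto
  then have "measure_pmf.prob Ind {\<omega>. \<omega> i = \<omega> j \<and> \<omega> i < D} \<le> measure_pmf.prob Ind (\<Union>x<D. ?C x)"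
    by (intro measure_pmf.finite_measure_mono) auto
  also have "\<dots> \<le> (\<Sum>x<D. measure_pmf.prob Ind (?C x))"
    by (intro measure_pmf.finite_measure_subadditive_finite) auto
  also have "\<dots> \<le> (\<Sum>x<D. (1 / real D)\<^sup>2)"
    using C by (intro sum_mono) auto
  also have "\<dots> = 1 / real D"
    using D by (simp add: power2_eq_square)
  finally show ?thesis .
qed

text \<open>Union bound over at most \<open>n^2\<close> ordered pairs: a draw avoiding the origin is
  injective or has a collision among the vertices.\<close>

lemma prob_distinct_draws_ge: "a ^ n - (real n)\<^sup>2 / real D \<le> measure_pmf.prob Ind distinct_draws"
proof -
  let ?S = "{p \<in> {1..n} \<times> {1..n}. fst p \<noteq> snd p}"
  let ?C = "\<lambda>p. {\<omega>. \<omega> (fst p) = \<omega> (snd p) \<and> \<omega> (fst p) < D}"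
  have S: "finite ?S" "card ?S \<le> n * n"
    using card_mono[of "{1..n} \<times> {1..n}" ?S] by auto
  have "- spike_hit \<subseteq> distinct_draws \<union> (\<Union>p\<in>?S. ?C p)"
  proof
    fix \<omega> assume "\<omega> \<in> - spike_hit"
    then have lt: "\<forall>k\<in>{1..n}. \<omega> k < D" by (auto simp: spike_hit_def not_le)
    show "\<omega> \<in> distinct_draws \<union> (\<Union>p\<in>?S. ?C p)"
    proof (cases "inj_on \<omega> {1..n}")
      case True
      then show ?thesis using lt by (simp add: distinct_draws_def)
    next
      case False
      then obtain i j where ij: "i \<in> {1..n}" "j \<in> {1..n}" "i \<noteq> j" "\<omega> i = \<omega> j"
        unfolding inj_on_def by blast
      then have "(i, j) \<in> ?S" "\<omega> \<in> ?C (i, j)" using lt by auto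
      then show ?thesis by blast
    qed
  qed
  then have "a ^ n \<le> measure_pmf.prob Ind (distinct_draws \<union> (\<Union>p\<in>?S. ?C p))"
    unfolding prob_no_hit[symmetric] by (intro measure_pmf.finite_measure_mono) auto
  also have "\<dots> \<le> measure_pmf.prob Ind distinct_draws + measure_pmf.prob Ind (\<Union>p\<in>?S. ?C p)"
    by (intro measure_Un_le) auto
  also have "measure_pmf.prob Ind (\<Union>p\<in>?S. ?C p) \<le> (\<Sum>p\<in>?S. measure_pmf.prob Ind (?C p))"
    using S(1) by (intro measure_pmf.finite_measure_subadditive_finite) auto
  also have "\<dots> \<le> (\<Sum>p\<in>?S. 1 / real D)"
    by (intro sum_mono prob_collision) auto
  also have "\<dots> \<le> (real n)\<^sup>2 / real D"
  proof -
    have "real (card ?S) \<le> real (n * n)"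
      using S(2) by (rule of_nat_mono)
    then show ?thesis
      using D by (simp add: divide_right_mono power2_eq_square)
  qed
  finally show ?thesis by simp
qed

section \<open>Variance bounds and separated samples\<close>

lemma variance_sample_law_ge:
  assumes g: "g \<in> borel_measurable (sample_law \<mu> n)" and "\<And>\<omega>. \<bar>g (draw \<omega>)\<bar> \<le> 1"
    and "\<And>\<omega>. \<omega> \<in> spike_hit \<Longrightarrow> g (draw \<omega>) \<le> 0"
    and "\<And>\<omega>. \<omega> \<in> distinct_draws \<Longrightarrow> c \<le> g (draw \<omega>)"
    and "0 \<le> c" "0 \<le> q" "q \<le> 1 - a ^ n" "q \<le> a ^ n - (real n)\<^sup>2 / real D"
  shows "q * c\<^sup>2 / 2 \<le> prob_space.variance (sample_law \<mu> n) g"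
proof -
  have "q * c\<^sup>2 / 2 \<le> measure_pmf.variance Ind (\<lambda>\<omega>. g (draw \<omega>))"
    using assms prob_hit prob_distinct_draws_ge
    by (intro measure_pmf.variance_ge_two_sets[where A = spike_hit and B = distinct_draws and K = 1])
      (auto simp: spike_hit_def distinct_draws_def simp flip: not_less)
  also have "\<dots> = prob_space.variance (sample_law \<mu> n) g"
    using g by (simp add: expectation_sample_law)
  finally show ?thesis .
qed

lemma card_image_draw_le: "real (card (\<omega> ` {1..n})) / real D \<le> real n / real D"
  using card_image_le[of "{1..n}" \<omega>] by (simp add: divide_right_mono)

text \<open>Both quantities vanish on \<open>spike_hit\<close>. On \<open>distinct_draws\<close> the
  missing mass is \<open>a * (1 - n / D)\<close> and the Good-Turing estimator is 1, so the smaller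
  value serves as \<open>c\<close> for both.\<close>

lemma min_variance_ge:
  assumes "n \<le> D" "0 \<le> q" "q \<le> 1 - a ^ n" "q \<le> a ^ n - (real n)\<^sup>2 / real D"
  shows "q * (a * (1 - real n / real D))\<^sup>2 / 2 \<le>
    min (prob_space.variance (sample_law \<mu> n) (cond_missing_mass D \<mu> n r))
        (prob_space.variance (sample_law \<mu> n) (good_turing D n r))"
proof -
  have c0: "0 \<le> 1 - real n / real D" and c1: "1 - real n / real D \<le> 1"
    using assms(1) D by auto
  have "a * (1 - real n / real D) \<le> cond_missing_mass D \<mu> n r (draw \<omega>)"
    if "\<omega> \<in> distinct_draws" for \<omega>
  proof -
    have "\<omega> \<notin> spike_hit"
      using that by (auto simp: spike_hit_def distinct_draws_def simp flip: not_less)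
    then show ?thesis
      using card_image_draw_le[of \<omega>] a by (simp add: cond_missing_mass_draw mult_left_mono)
  qed
  moreover have "\<bar>cond_missing_mass D \<mu> n r (draw \<omega>)\<bar> \<le> 1" for \<omega>
    by (simp add: cond_missing_mass_eq[OF draw_in_space])
  moreover have "cond_missing_mass D \<mu> n r (draw \<omega>) \<le> 0" if "\<omega> \<in> spike_hit" for \<omega>
    using that by (simp add: cond_missing_mass_draw)
  ultimately have "q * (a * (1 - real n / real D))\<^sup>2 / 2 \<le>
      prob_space.variance (sample_law \<mu> n) (cond_missing_mass D \<mu> n r)"
    using assms a c0 cond_missing_mass_measurable
    by (intro variance_sample_law_ge) auto
  moreover have "q * (a * (1 - real n / real D))\<^sup>2 / 2 \<le>
      prob_space.variance (sample_law \<mu> n) (good_turing D n r)"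
    using assms a c0 c1 mult_mono[OF a(2) c1] good_turing_draw_bounds
    by (intro variance_sample_law_ge good_turing_measurable sets_mu)
      (auto simp: good_turing_draw_hit good_turing_draw_distinct)
  ultimately show ?thesis by simp
qed

lemma prob_separated_ge:
  "a ^ n - (real n)\<^sup>2 / real D \<le> measure (sample_law \<mu> n)
     {X \<in> space (sample_law \<mu> n). \<forall>i\<in>{1..n}. \<forall>j\<in>{1..n}. i \<noteq> j \<longrightarrow>
        dist_RD D (X i) (X j) > r \<and> norm_RD D (X i) \<le> 1}" (is "_ \<le> measure _ ?E")
proof -
  note [measurable] = dist_RD_sample_measurable[OF sets_mu] norm_RD_sample_measurable[OF sets_mu]
  have E: "?E \<in> sets (sample_law \<mu> n)"
    by measurable
  have "distinct_draws \<subseteq> draw -` ?E"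
  proof
    fix \<omega> assume \<omega>: "\<omega> \<in> distinct_draws"
    have "r < dist_RD D (draw \<omega> i) (draw \<omega> j)" if "i \<in> {1..n}" "j \<in> {1..n}" "i \<noteq> j" for i j
      using \<omega> that unfolding dist_draw[OF that(1,2)] distinct_draws_def inj_on_def by blast
    moreover have "norm_RD D (draw \<omega> i) \<le> 1" if "i \<in> {1..n}" for i
      using that by (simp add: draw_def norm_RD_vertex)
    ultimately show "\<omega> \<in> draw -` ?E" using draw_in_space by simp
  qed
  then have "measure_pmf.prob Ind distinct_draws \<le> measure_pmf.prob Ind (draw -` ?E)"
    by (intro measure_pmf.finite_measure_mono) auto
  also have "\<dots> = measure (sample_law \<mu> n) ?E"
    by (subst (2) sample_law_eq, subst measure_distr[OF draw_measurable E]) simp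
  finally show ?thesis
    using prob_distinct_draws_ge by simp
qed

section \<open>Expected missing mass and comparison of risks with uniform draws\<close>

lemma missing_mass_eq:
  "missing_mass D \<mu> n r = measure_pmf.expectation Ind (\<lambda>\<omega>. cond_missing_mass D \<mu> n r (draw \<omega>))"
  unfolding missing_mass_def by (rule expectation_sample_law[OF cond_missing_mass_measurable])

lemma integrable_cond_missing_mass_draw:
  "integrable (measure_pmf Ind) (\<lambda>\<omega>. cond_missing_mass D \<mu> n r (draw \<omega>))"
  by (rule measure_pmf.integrable_const_bound[where B = 1])
    (auto simp: cond_missing_mass_eq[OF draw_in_space])

lemma missing_mass_le: "missing_mass D \<mu> n r \<le> a ^ n"
proof -
  have "missing_mass D \<mu> n r \<le> measure_pmf.expectation Ind (indicator (- spike_hit))"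
    unfolding missing_mass_eq
  proof (rule integral_mono[OF integrable_cond_missing_mass_draw])
    fix \<omega>
    show "cond_missing_mass D \<mu> n r (draw \<omega>) \<le> indicator (- spike_hit) \<omega>"
      by (cases "\<omega> \<in> spike_hit")
        (simp add: cond_missing_mass_draw, simp add: cond_missing_mass_eq[OF draw_in_space])
  qed (auto simp: measure_pmf.emeasure_eq_measure)
  then show ?thesis
    using prob_no_hit by simp
qed

text \<open>The power \<open>a ^ n\<close> is the probability of avoiding the origin; the extra
  factor \<open>a\<close> is the total mass of the basis vectors. At most \<open>n\<close> of them
  are covered, and repeated draws only enlarge the missing mass.\<close>

lemma missing_mass_ge: "a ^ Suc n * (1 - real n / real D) \<le> missing_mass D \<mu> n r"
proof -
  let ?c = "a * (1 - real n / real D)"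
  have "measure_pmf.expectation Ind (\<lambda>\<omega>. ?c * indicator (- spike_hit) \<omega>) \<le> missing_mass D \<mu> n r"
    unfolding missing_mass_eq
  proof (rule integral_mono[OF _ integrable_cond_missing_mass_draw])
    fix \<omega>
    show "?c * indicator (- spike_hit) \<omega> \<le> cond_missing_mass D \<mu> n r (draw \<omega>)"
      using a card_image_draw_le[of \<omega>]
      by (cases "\<omega> \<in> spike_hit") (auto simp: cond_missing_mass_draw intro!: mult_left_mono)
  qed (auto simp: measure_pmf.emeasure_eq_measure)
  then show ?thesis
    using prob_no_hit by (simp add: mult_ac)
qed

text \<open>The integral on the left is the same for every \<open>a\<close>, because
  \<open>draw\<close> does not involve \<open>a\<close>. Risks under different spikes thus become
  comparable on one discrete space.\<close>

lemma mean_square_sample_law_ge: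
  "ennreal (a ^ n) * (\<integral>\<^sup>+\<omega>. ennreal ((g (draw \<omega>))\<^sup>2) \<partial>Pi_pmf {1..n} 0 (\<lambda>_. spiked_uniform D 1))
     \<le> mean_square (sample_law \<mu> n) g"
proof -
  have "finite (set_pmf Ind)"
    unfolding Ind_def by (simp add: set_Pi_pmf finite_PiE_dflt finite_set_P)
  have "ennreal (a ^ n) * (\<integral>\<^sup>+\<omega>. ennreal ((g (draw \<omega>))\<^sup>2) \<partial>Pi_pmf {1..n} 0 (\<lambda>_. spiked_uniform D 1))
      \<le> (\<integral>\<^sup>+\<omega>. ennreal ((g (draw \<omega>))\<^sup>2) \<partial>Ind)"
    using a(1) pmf_Ind_ge by (intro nn_integral_pmf_ge) auto
  also have "\<dots> \<le> (\<integral>\<^sup>+X. ennreal ((g X)\<^sup>2) \<partial>distr (measure_pmf Ind) (sample_law \<mu> n) draw)"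
    by (rule nn_integral_distr_ge[OF draw_in_space \<open>finite (set_pmf Ind)\<close>])
      (rule singleton_sample_measurable[OF sets_mu])
  also have "\<dots> = mean_square (sample_law \<mu> n) g"
    unfolding mean_square_def by (subst (2) sample_law_eq) (rule refl)
  finally show ?thesis .
qed

end

subsection \<open>Lower bounds on the risk\<close>

text \<open>If both risks were below \<open>c\<close>, then \<open>2 * R1 + R2 < 3 * c\<close>,
  whereas integrating a pointwise quadratic bound gives at least \<open>(m2 - m1)^2 / 3\<close>. The
  weight 2 is the optimal one: at the minimizer, \<open>u^2 / 4\<close> and \<open>(u - d)^2\<close>
  both equal \<open>d^2 / 9\<close>.\<close>

lemma two_point_risk:
  fixes h :: "'a \<Rightarrow> real"
  assumes R1: "ennreal (1 / 4) * (\<integral>\<^sup>+x. ennreal ((h x - m1)\<^sup>2) \<partial>measure_pmf p) \<le> R1"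
    and R2: "(\<integral>\<^sup>+x. ennreal ((h x - m2)\<^sup>2) \<partial>measure_pmf p) \<le> R2"
    and c: "0 \<le> c" "c \<le> (m2 - m1)\<^sup>2 / 9"
  shows "ennreal c \<le> R1 \<or> ennreal c \<le> R2"
proof (rule ccontr)
  assume "\<not> ?thesis"
  then have lt: "R1 < ennreal c" "R2 < ennreal c" by auto
  let ?A = "\<integral>\<^sup>+x. ennreal ((h x - m1)\<^sup>2) \<partial>measure_pmf p"
  let ?B = "\<integral>\<^sup>+x. ennreal ((h x - m2)\<^sup>2) \<partial>measure_pmf p"
  have A: "ennreal (1 / 4) * ?A < ennreal c" and B: "?B < ennreal c"
    using R1 R2 lt by (auto intro: order.strict_trans1)
  have split: "ennreal (1 / 2) * ennreal u + ennreal v = ennreal (1 / 2 * u + v)"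
    if "0 \<le> u" "0 \<le> v" for u v
  proof -
    have "ennreal (1 / 2 * u + v) = ennreal (1 / 2 * u) + ennreal v"
      by (rule ennreal_plus) (use that in auto)
    also have "ennreal (1 / 2 * u) = ennreal (1 / 2) * ennreal u"
      by (rule ennreal_mult) (use that in auto)
    finally show ?thesis ..
  qed
  have "?A \<noteq> top" using A by (auto simp: ennreal_mult_top)
  then obtain x where x: "?A = ennreal x" "0 \<le> x" by (cases ?A) auto
  have "?B \<noteq> top" using B by auto
  then obtain y where y: "?B = ennreal y" "0 \<le> y" by (cases ?B) auto
  have "x / 4 < c" "y < c"
    using A B x y c(1) by (auto simp: ennreal_less_iff simp flip: ennreal_mult)
  \<comment> \<open>Minimizing \<open>u\<^sup>2 / 2 + (u - d)\<^sup>2\<close> over \<open>u\<close> gives \<open>d\<^sup>2 / 3\<close>, attained at \<open>u = 2 d / 3\<close>.\<close>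
  have "3 * c \<le> 1 / 2 * (h z - m1)\<^sup>2 + (h z - m2)\<^sup>2" for z
  proof -
    have "1 / 2 * (h z - m1)\<^sup>2 + (h z - m2)\<^sup>2 =
        (m2 - m1)\<^sup>2 / 3 + 3 / 2 * (h z - m1 - 2 / 3 * (m2 - m1))\<^sup>2"
      by (simp add: power2_eq_square field_simps)
    then show ?thesis using c(2) zero_le_power2[of "h z - m1 - 2 / 3 * (m2 - m1)"] by linarith
  qed
  then have "(\<integral>\<^sup>+z. ennreal (3 * c) \<partial>measure_pmf p) \<le>
      (\<integral>\<^sup>+z. ennreal (1 / 2) * ennreal ((h z - m1)\<^sup>2) + ennreal ((h z - m2)\<^sup>2) \<partial>measure_pmf p)"
    by (intro nn_integral_mono) (simp only: split zero_le_power2 ennreal_leI)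
  also have "\<dots> = ennreal (1 / 2) * ?A + ?B"
    by (simp add: nn_integral_add nn_integral_cmult)
  also have "\<dots> = ennreal (1 / 2 * x + y)"
    unfolding x(1) y(1) using x(2) y(2) by (rule split)
  finally have "ennreal (3 * c) \<le> ennreal (1 / 2 * x + y)"
    by (simp only: nn_integral_const measure_pmf.emeasure_space_1 mult_1_right)
  moreover have "0 \<le> 1 / 2 * x + y"
    using x(2) y(2) by simp
  ultimately have "3 * c \<le> 1 / 2 * x + y"
    by (simp only: ennreal_le_iff)
  with \<open>x / 4 < c\<close> \<open>y < c\<close> show False by simp
qed

lemma L2_norm_ge:
  assumes "0 \<le> t" "ennreal (t\<^sup>2) \<le> mean_square M g"
  shows "ennreal t \<le> L2_norm M g"
proof (cases "mean_square M g = \<infinity>")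
  case False
  then obtain x where x: "mean_square M g = ennreal x" "0 \<le> x"
    by (cases "mean_square M g") auto
  then have "t\<^sup>2 \<le> x" using assms(2) by (simp add: ennreal_le_iff)
  then have "t \<le> sqrt x" using assms(1) by (intro real_le_rsqrt)
  then show ?thesis using x False by (simp add: L2_norm_def ennreal_leI)
qed (simp add: L2_norm_def)

lemma exp_neg_ln_div_power:
  assumes "0 < n" "0 < t"
  shows "exp (- ln t / real n) ^ n = 1 / t"
proof -
  have "exp (- ln t / real n) ^ n = exp (real n * (- ln t / real n))"
    by (rule exp_of_nat_mult[symmetric])
  also have "\<dots> = 1 / t"
    using assms by (simp add: exp_minus inverse_eq_divide)
  finally show ?thesis .
qed

theorem proposition2p6:
  fixes r :: real
  assumes "1 < r" and "r < sqrt 2"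
  shows "\<forall>\<epsilon>::real. 0 < \<epsilon> \<and> \<epsilon> < 1 \<longrightarrow> (\<forall>n::nat. real n \<ge> ln 4 / \<epsilon> \<longrightarrow>
    (\<exists>D::nat. D \<ge> 1 \<and> (\<exists>\<mu>. borel_prob_RD D \<mu> \<and>
       min (prob_space.variance (sample_law \<mu> n) (cond_missing_mass D \<mu> n r))
           (prob_space.variance (sample_law \<mu> n) (good_turing D n r)) \<ge> 1/4 - \<epsilon> \<and>
       measure (sample_law \<mu> n)
         {X \<in> space (sample_law \<mu> n). \<forall>i\<in>{1..n}. \<forall>j\<in>{1..n}. i \<noteq> j \<longrightarrow>
            dist_RD D (X i) (X j) > r \<and> norm_RD D (X i) \<le> 1} \<ge> 1/2 - \<epsilon> \<and>
       (\<forall>f :: (nat \<Rightarrow> nat \<Rightarrow> real) \<Rightarrow> real. \<exists>\<mu>''. borel_prob_RD D \<mu>'' \<and>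
          mean_square (sample_law \<mu>'' n) (\<lambda>X. f X - missing_mass D \<mu>'' n r)
            \<ge> ennreal ((1 - \<epsilon>)\<^sup>2 / 16) \<and>
          L2_norm (sample_law \<mu>'' n) (\<lambda>X. missing_mass D \<mu>'' n r - f X)
            \<ge> ennreal ((1 - \<epsilon>) / 4)))))"
proof (intro allI impI, goal_cases)
  case (1 \<epsilon> n)
  note \<epsilon> = 1(1) and n = 1(2)
  have ln4: "ln 4 = 2 * ln (2::real)"
    using ln_realpow[of 2 2] by simp
  have "1 < ln (4::real)"
    using ln2_ge_two_thirds ln4 by simp
  also have "ln 4 \<le> ln 4 / \<epsilon>"
    using \<epsilon> by (simp add: le_divide_eq)
  finally have n2: "2 \<le> n"
    using n by simp
  \<comment> \<open>Makes the collision bound \<open>n^2 / D\<close>, and with it the covered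
    fraction \<open>n / D\<close>, at most \<open>\<epsilon> / 4\<close>.\<close>
  define D where "D = nat \<lceil>4 * (real n)\<^sup>2 / \<epsilon>\<rceil>"
  have "4 * (real n)\<^sup>2 / \<epsilon> \<le> real D"
    unfolding D_def by (rule real_nat_ceiling_ge)
  moreover from this have "0 < D"
    using n2 \<epsilon> by (cases "D = 0") (auto simp: divide_le_0_iff)
  ultimately have D: "0 < D" "(real n)\<^sup>2 / real D \<le> \<epsilon> / 4"
    using \<epsilon> by (simp_all add: field_simps)
  have nD: "real n / real D \<le> \<epsilon> / 4"
  proof -
    have "real n / real D \<le> (real n)\<^sup>2 / real D"
      using n2 by (intro divide_right_mono) (auto simp: power2_eq_square)
    then show ?thesis using D(2) by (rule order_trans)
  qed
  then have "real n / real D \<le> 1"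
    using \<epsilon> by linarith
  then have le: "n \<le> D"
    using D(1) by simp
  \<comment> \<open>Gives \<open>a ^ n = 1 / 2\<close>, balancing hits and misses of the origin.
    Since \<open>ln 4 = 2 * ln 2\<close>, the lower bound on \<open>n\<close> yields
    \<open>1 - \<epsilon> / 2 \<le> a\<close>.\<close>
  define a where "a = exp (- ln 2 / real n)"
  have a: "0 \<le> a" "a \<le> 1" "a ^ n = 1 / 2" "1 - \<epsilon> / 2 \<le> a"
  proof -
    show "a ^ n = 1 / 2"
      unfolding a_def using n2 by (intro exp_neg_ln_div_power) auto
    have "ln 2 / real n \<le> \<epsilon> / 2"
      using n n2 \<epsilon> ln4 by (simp add: field_simps)
    moreover have "1 - ln 2 / real n \<le> a"
      using exp_ge_add_one_self[of "- ln 2 / real n"] by (simp add: a_def)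
    ultimately show "1 - \<epsilon> / 2 \<le> a" by linarith
  qed (auto simp: a_def)
  define b where "b = exp (- ln 4 / real n)"
  have b: "0 \<le> b" "b \<le> 1" "b ^ n = 1 / 4"
    using n2 exp_neg_ln_div_power[of n 4] by (auto simp: b_def)
  interpret V: spiked_sample D n a r
    by unfold_locales (use D n2 a assms in auto)
  interpret H: spiked_sample D n b r
    by unfold_locales (use D n2 b assms in auto)
  interpret U: spiked_sample D n 1 r
    by unfold_locales (use D n2 assms in auto)
  have "1 / 4 - \<epsilon> \<le> (1 / 2 - \<epsilon> / 4) * (a * (1 - real n / real D))\<^sup>2 / 2"
  proof -
    define Y where "Y = (a * (1 - real n / real D))\<^sup>2"
    have nD': "1 - \<epsilon> / 2 \<le> 1 - real n / real D"
      using nD \<epsilon> by linarith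
    have "1 - 5 * (\<epsilon> / 2) \<le> (1 - \<epsilon> / 2) ^ 5"
      using Bernoulli_inequality[of "- (\<epsilon> / 2)" 5] \<epsilon> by simp
    also have "\<dots> = (1 - \<epsilon> / 2) * ((1 - \<epsilon> / 2) * (1 - \<epsilon> / 2))\<^sup>2"
      by (simp add: power2_eq_square power_numeral_reduce)
    also have "\<dots> \<le> (1 - \<epsilon> / 2) * Y"
      unfolding Y_def using \<epsilon> a(1,4) by (intro mult_left_mono power_mono mult_mono nD') auto
    finally have "1 - 5 * (\<epsilon> / 2) \<le> (1 - \<epsilon> / 2) * Y" .
    moreover have "(1 / 2 - \<epsilon> / 4) * Y / 2 = (1 - \<epsilon> / 2) * Y / 4"
      by (simp add: field_simps)
    ultimately show ?thesis
      using \<epsilon> unfolding Y_def by linarith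
  qed
  also have "\<dots> \<le> min (prob_space.variance (sample_law V.\<mu> n) (cond_missing_mass D V.\<mu> n r))
      (prob_space.variance (sample_law V.\<mu> n) (good_turing D n r))"
    by (rule V.min_variance_ge) (use le \<epsilon> a(3) D(2) in linarith)+
  finally have variance: "1 / 4 - \<epsilon> \<le>
    min (prob_space.variance (sample_law V.\<mu> n) (cond_missing_mass D V.\<mu> n r))
      (prob_space.variance (sample_law V.\<mu> n) (good_turing D n r))" .
  have separated: "1 / 2 - \<epsilon> \<le> measure (sample_law V.\<mu> n)
     {X \<in> space (sample_law V.\<mu> n). \<forall>i\<in>{1..n}. \<forall>j\<in>{1..n}. i \<noteq> j \<longrightarrow>
        dist_RD D (X i) (X j) > r \<and> norm_RD D (X i) \<le> 1}"
    using V.prob_separated_ge a(3) D(2) \<epsilon> by linarith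
  have risk: "\<exists>\<mu>''. borel_prob_RD D \<mu>'' \<and>
      mean_square (sample_law \<mu>'' n) (\<lambda>X. f X - missing_mass D \<mu>'' n r)
        \<ge> ennreal ((1 - \<epsilon>)\<^sup>2 / 16) \<and>
      L2_norm (sample_law \<mu>'' n) (\<lambda>X. missing_mass D \<mu>'' n r - f X)
        \<ge> ennreal ((1 - \<epsilon>) / 4)" for f :: "(nat \<Rightarrow> nat \<Rightarrow> real) \<Rightarrow> real"
  proof -
    define M1 where "M1 = missing_mass D H.\<mu> n r"
    define M2 where "M2 = missing_mass D U.\<mu> n r"
    have "M1 \<le> 1 / 4"
      using H.missing_mass_le b(3) by (simp add: M1_def)
    moreover have "1 - real n / real D \<le> M2"
      using U.missing_mass_ge by (simp add: M2_def)
    ultimately have "3 / 4 * (1 - \<epsilon>) \<le> M2 - M1"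
      using \<epsilon> nD by (simp only: right_diff_distrib) linarith
    then have "(3 / 4 * (1 - \<epsilon>))\<^sup>2 \<le> (M2 - M1)\<^sup>2"
      using \<epsilon> by (intro power_mono) auto
    then have gap: "(1 - \<epsilon>)\<^sup>2 / 16 \<le> (M2 - M1)\<^sup>2 / 9"
      unfolding power_mult_distrib by (simp add: power_divide)
    have "ennreal ((1 - \<epsilon>)\<^sup>2 / 16) \<le> mean_square (sample_law H.\<mu> n) (\<lambda>X. f X - M1) \<or>
        ennreal ((1 - \<epsilon>)\<^sup>2 / 16) \<le> mean_square (sample_law U.\<mu> n) (\<lambda>X. f X - M2)"
      using H.mean_square_sample_law_ge[of "\<lambda>X. f X - M1"]
        U.mean_square_sample_law_ge[of "\<lambda>X. f X - M2"]
      by (intro two_point_risk[OF _ _ _ gap]) (simp_all add: b(3))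
    then obtain \<mu>'' where \<mu>'': "borel_prob_RD D \<mu>''"
      "ennreal ((1 - \<epsilon>)\<^sup>2 / 16) \<le> mean_square (sample_law \<mu>'' n) (\<lambda>X. f X - missing_mass D \<mu>'' n r)"
      using H.borel_prob_mu U.borel_prob_mu unfolding M1_def M2_def by blast
    have "mean_square (sample_law \<mu>'' n) (\<lambda>X. missing_mass D \<mu>'' n r - f X) =
        mean_square (sample_law \<mu>'' n) (\<lambda>X. f X - missing_mass D \<mu>'' n r)"
      by (simp add: mean_square_def power2_commute)
    then have "ennreal ((1 - \<epsilon>) / 4) \<le> L2_norm (sample_law \<mu>'' n) (\<lambda>X. missing_mass D \<mu>'' n r - f X)"
      using \<mu>''(2) \<epsilon> by (intro L2_norm_ge) (simp_all add: power_divide)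
    with \<mu>'' show ?thesis by blast
  qed
  show ?case
  proof (rule exI[of _ D], rule conjI)
    show "1 \<le> D" using D(1) by simp
  qed (rule exI[of _ V.\<mu>], intro conjI allI V.borel_prob_mu variance separated risk)
qed

end
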